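(* Let $\alpha>0$ be a constant and let $0<c<\alpha$ be any constant. Let $G$ be an $n$-vertex graph with minimum degree at least $\alpha n$. Then in the RandomWalker game on $G$, Breaker has a strategy such that with high probability (i.e. with probability tending to $1$ as $n\to\infty$) RandomWalker visits at most $n-c\log n$ vertices.
   Context: The RandomWalker game on a graph $G$: RandomWalker starts at a vertex of $G$ (which counts as visited), and moves alternate with Breaker's moves. On Breaker's move he acquires one edge of $G$ (not yet traversed by the walker). On RandomWalker's move, if she is at vertex $v$, she moves to a neighbour $w$ of $v$ chosen uniformly at random among those $w$ for which the edge $vw$ has not been acquired by Breaker; $w$ becomes visited. The game ends when there is no path from RandomWalker's current position to an unvisited vertex along edges not acquired by Breaker. Breaker aims to minimize the number of vertices visited. *)

theory Defs
  imports "HOL-Probability.Probability"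
begin

definition simple_graph :: "'a set \<Rightarrow> 'a set set \<Rightarrow> bool" where
  "simple_graph V E \<longleftrightarrow> finite V \<and> V \<noteq> {} \<and> (\<forall>e\<in>E. e \<subseteq> V \<and> card e = 2)"

definition degree :: "'a set set \<Rightarrow> 'a \<Rightarrow> nat" where
  "degree E v = card {w. {v, w} \<in> E}"

definition min_degree :: "'a set \<Rightarrow> 'a set set \<Rightarrow> nat" where
  "min_degree V E = Min (degree E ` V)"

datatype player = Walker | Breaker

(* The list of vertices occupied by the walker and the list of edges acquired by Breaker
   are both stored with the most recent entry first. *)
datatype 'a history =
  History (to_move: player) (walk: "'a list") (acquired: "'a set list")

definition visited :: "'a history \<Rightarrow> 'a set" where
  "visited h = set (walk h)"

definition position :: "'a history \<Rightarrow> 'a" where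
  "position h = hd (walk h)"

definition traversed :: "'a history \<Rightarrow> 'a set set" where
  "traversed h = {{walk h ! i, walk h ! Suc i} | i. Suc i < length (walk h)}"

definition open_edges :: "'a set set \<Rightarrow> 'a history \<Rightarrow> 'a set set" where
  "open_edges E h = E - set (acquired h)"

definition ended :: "'a set \<Rightarrow> 'a set set \<Rightarrow> 'a history \<Rightarrow> bool" where
  "ended V E h \<longleftrightarrow>
     \<not> (\<exists>w \<in> V - visited h. (position h, w) \<in> {(x, y). {x, y} \<in> open_edges E h}\<^sup>*)"

definition breaker_moves :: "'a set set \<Rightarrow> 'a history \<Rightarrow> 'a set set" where
  "breaker_moves E h = open_edges E h - traversed h"

definition walker_moves :: "'a set set \<Rightarrow> 'a history \<Rightarrow> 'a set" where
  "walker_moves E h = {w. {position h, w} \<in> open_edges E h}"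

(* Strategies are deterministic and may depend on the whole history.  The guard only concerns
   histories at which the game is over or which cannot arise; see breaker_moves_nonempty. *)
definition breaker_strategy :: "'a set set \<Rightarrow> ('a history \<Rightarrow> 'a set) \<Rightarrow> bool" where
  "breaker_strategy E \<sigma> \<longleftrightarrow>
     (\<forall>h. to_move h = Breaker \<and> breaker_moves E h \<noteq> {} \<longrightarrow> \<sigma> h \<in> breaker_moves E h)"

definition step ::
  "'a set \<Rightarrow> 'a set set \<Rightarrow> ('a history \<Rightarrow> 'a set) \<Rightarrow> 'a history \<Rightarrow> 'a history pmf" where
  "step V E \<sigma> h =
     (if ended V E h then return_pmf h
      else case to_move h of
        Breaker \<Rightarrow> return_pmf (History Walker (walk h) (\<sigma> h # acquired h))
      | Walker \<Rightarrow> map_pmf (\<lambda>w. History Breaker (w # walk h) (acquired h))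
                    (pmf_of_set (walker_moves E h)))"

primrec play ::
  "'a set \<Rightarrow> 'a set set \<Rightarrow> ('a history \<Rightarrow> 'a set) \<Rightarrow> player \<Rightarrow> 'a \<Rightarrow> nat \<Rightarrow> 'a history pmf" where
  "play V E \<sigma> first v 0 = return_pmf (History first [v] [])"
| "play V E \<sigma> first v (Suc t) = bind_pmf (play V E \<sigma> first v t) (step V E \<sigma>)"

(* Every move of Breaker uses up an edge and finished games are left unchanged by step,
   so the game is always over after 2 * card E moves; see game_outcome_ended. *)
definition game_outcome ::
  "'a set \<Rightarrow> 'a set set \<Rightarrow> ('a history \<Rightarrow> 'a set) \<Rightarrow> player \<Rightarrow> 'a \<Rightarrow> 'a history pmf" where
  "game_outcome V E \<sigma> first v = play V E \<sigma> first v (2 * card E)"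

lemma traversed_subset_visited: "e \<in> traversed h \<Longrightarrow> e \<subseteq> visited h"
  unfolding traversed_def visited_def by auto

lemma position_visited: "walk h \<noteq> [] \<Longrightarrow> position h \<in> visited h"
  by (simp add: position_def visited_def)

lemma breaker_moves_nonempty:
  assumes "walk h \<noteq> []" "\<not> ended V E h"
  shows "breaker_moves E h \<noteq> {}"
proof -
  obtain w where w: "w \<notin> visited h"
      "(position h, w) \<in> {(x, y). {x, y} \<in> open_edges E h}\<^sup>*"
    using assms(2) unfolding ended_def by auto
  have "position h \<noteq> w" using w(1) position_visited[OF assms(1)] by auto
  then obtain x where "{x, w} \<in> open_edges E h"
    using w(2) by (auto elim: rtranclE)
  moreover have "{x, w} \<notin> traversed h"
    using w(1) traversed_subset_visited by blast
  ultimately show ?thesis unfolding breaker_moves_def by blast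
qed

lemma walker_moves_nonempty:
  assumes "walk h \<noteq> []" "\<not> ended V E h"
  shows "walker_moves E h \<noteq> {}"
proof -
  obtain w where w: "w \<notin> visited h"
      "(position h, w) \<in> {(x, y). {x, y} \<in> open_edges E h}\<^sup>*"
    using assms(2) unfolding ended_def by auto
  have "position h \<noteq> w" using w(1) position_visited[OF assms(1)] by auto
  then obtain x where "{position h, x} \<in> open_edges E h"
    using w(2) by (auto elim: converse_rtranclE)
  then show ?thesis unfolding walker_moves_def by blast
qed

lemma finite_edges:
  assumes "simple_graph V E"
  shows "finite E"
proof -
  have "E \<subseteq> Pow V" using assms by (auto simp: simple_graph_def)
  then show ?thesis using assms by (auto simp: simple_graph_def intro: finite_subset)
qed

lemma finite_walker_moves:
  assumes "simple_graph V E"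
  shows "finite (walker_moves E h)"
proof -
  have "walker_moves E h \<subseteq> V"
    using assms by (auto simp: simple_graph_def walker_moves_def open_edges_def)
  then show ?thesis using assms by (auto simp: simple_graph_def intro: finite_subset)
qed

lemma play_invariant:
  assumes "simple_graph V E" "breaker_strategy E \<sigma>" "h \<in> set_pmf (play V E \<sigma> first v t)"
  shows "walk h \<noteq> [] \<and> distinct (acquired h) \<and> set (acquired h) \<subseteq> E \<and>
    (ended V E h \<or>
      (if to_move h = first then t = 2 * length (acquired h)
       else if first = Walker then t = 2 * length (acquired h) + 1
       else t + 1 = 2 * length (acquired h)))"
  using assms(3)
proof (induction t arbitrary: h)
  case 0
  then show ?case by simp
next
  case (Suc t)
  then obtain g where g: "g \<in> set_pmf (play V E \<sigma> first v t)" "h \<in> set_pmf (step V E \<sigma> g)"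
    by auto
  note IH = Suc.IH[OF g(1)]
  show ?case
  proof (cases "ended V E g")
    case True
    then show ?thesis using g(2) IH by (simp add: step_def)
  next
    case False
    show ?thesis
    proof (cases "to_move g")
      case Breaker
      have h: "h = History Walker (walk g) (\<sigma> g # acquired g)"
        using g(2) False Breaker by (simp add: step_def)
      have "\<sigma> g \<in> breaker_moves E g"
        using assms(2) Breaker breaker_moves_nonempty[OF _ False] IH
        unfolding breaker_strategy_def by blast
      then show ?thesis using IH False Breaker h
        by (cases first) (auto simp: breaker_moves_def open_edges_def)
    next
      case Walker
      obtain w where h: "h = History Breaker (w # walk g) (acquired g)"
        using g(2) False Walker by (auto simp: step_def)
      then show ?thesis using IH False Walker by (cases first) auto
    qed
  qed
qed

lemma game_outcome_ended:
  assumes "simple_graph V E" "breaker_strategy E \<sigma>"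
    and "h \<in> set_pmf (game_outcome V E \<sigma> first v)"
  shows "ended V E h"
proof (rule ccontr)
  assume ne: "\<not> ended V E h"
  note inv = play_invariant[OF assms(1,2) assms(3)[unfolded game_outcome_def]]
  have "card E \<le> length (acquired h)"
    using inv ne by (auto split: if_splits)
  then have "card E \<le> card (set (acquired h))"
    using inv by (simp add: distinct_card)
  then have "set (acquired h) = E"
    using inv finite_edges[OF assms(1)] by (metis card_seteq)
  then have "breaker_moves E h = {}" by (simp add: breaker_moves_def open_edges_def)
  then show False using breaker_moves_nonempty[OF _ ne] inv by blast
qed

end

theory Submission
  imports Defs "HOL-Real_Asymp.Real_Asymp"
begin

text \<open>
  Breaker ranks the vertices and always works on the unvisited vertex of least rank that is not
  yet isolated, first taking its edge to the walker's position if that edge is available. A vertex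
  under attack is thus never visited, so each stretch of at most \<open>n\<close> moves isolates one more vertex,
  and the walker's position loses at most \<open>k\<close> edges before \<open>k\<close> vertices are isolated. Until then a
  walker's move visits a new vertex with probability at most \<open>U / N\<close>, where \<open>U\<close> is the number of
  unvisited vertices and \<open>N = \<alpha> * n - k\<close>, and hence increases the expectation of \<open>1 / (U + 1)\<close> by a
  factor of at most \<open>1 + 1 / N\<close>. As there are at most \<open>k * n + 1\<close> such moves, Markov's inequality
  bounds the probability of \<open>U < k\<close> at the end by \<open>k / n * (1 + 1 / N) ^ (k * n + 1)\<close>, which is
  \<open>n powr (c / \<alpha> - 1)\<close> up to logarithmic factors for \<open>k = \<lceil>c * ln n\<rceil>\<close>.
\<close>

section \<open>Isolated vertices and the current target of Breaker\<close>

definition unvisited :: "'a set \<Rightarrow> 'a history \<Rightarrow> 'a set" where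
  "unvisited V h = V - visited h"

definition isolated :: "'a set \<Rightarrow> 'a set set \<Rightarrow> 'a history \<Rightarrow> 'a set" where
  "isolated V E h = unvisited V h - \<Union>(open_edges E h)"

text \<open>A set rather than a choice: it is empty once no unvisited vertex has an open edge, and
  injectivity of \<open>prio\<close> on \<open>V\<close> makes it at most a singleton.\<close>

definition targets :: "'a set \<Rightarrow> 'a set set \<Rightarrow> ('a \<Rightarrow> nat) \<Rightarrow> 'a history \<Rightarrow> 'a set" where
  "targets V E prio h =
     {v \<in> unvisited V h \<inter> \<Union>(open_edges E h).
        \<forall>u \<in> unvisited V h \<inter> \<Union>(open_edges E h). prio v \<le> prio u}"

lemma isolated_subset_unvisited: "isolated V E h \<subseteq> unvisited V h"
  by (auto simp: isolated_def)

lemma targets_subset_unvisited: "targets V E prio h \<subseteq> unvisited V h"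
  by (auto simp: targets_def)

text \<open>Shrinking the set of candidates keeps its minimum as long as that minimum survives. So a
  rule without memory makes Breaker stay with one vertex until it is isolated.\<close>

lemma targets_anti_mono:
  assumes "v \<in> targets V E prio h" "unvisited V h' \<subseteq> unvisited V h"
    "open_edges E h' \<subseteq> open_edges E h" "v \<in> unvisited V h'" "v \<in> \<Union>(open_edges E h')"
  shows "v \<in> targets V E prio h'"
  using assms unfolding targets_def by blast

lemma not_ended_unvisited_open:
  assumes "walk h \<noteq> []" "\<not> ended V E h"
  shows "unvisited V h \<inter> \<Union>(open_edges E h) \<noteq> {}"
proof -
  obtain w where w: "w \<in> V - visited h"
      "(position h, w) \<in> {(x, y). {x, y} \<in> open_edges E h}\<^sup>*"
    using assms(2) unfolding ended_def by auto
  have "position h \<noteq> w" using w(1) position_visited[OF assms(1)] by auto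
  then obtain x where "{x, w} \<in> open_edges E h"
    using w(2) by (auto elim: rtranclE)
  then show ?thesis using w(1) unfolding unvisited_def by blast
qed

lemma not_ended_target:
  assumes "walk h \<noteq> []" "\<not> ended V E h"
  shows "\<exists>v. v \<in> targets V E prio h"
proof -
  obtain v where "v \<in> unvisited V h \<inter> \<Union>(open_edges E h)"
    using not_ended_unvisited_open[OF assms] by blast
  then obtain v where "v \<in> unvisited V h \<inter> \<Union>(open_edges E h)"
    "\<And>u. prio u < prio v \<Longrightarrow> u \<notin> unvisited V h \<inter> \<Union>(open_edges E h)"
    using exists_least_iff[of "\<lambda>m. \<exists>v. v \<in> unvisited V h \<inter> \<Union>(open_edges E h) \<and> m = prio v"]
    by metis
  moreover have "prio v \<le> prio u" if "u \<in> unvisited V h \<inter> \<Union>(open_edges E h)" for u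
    using calculation(2) that by (meson not_le_imp_less)
  ultimately have "v \<in> targets V E prio h"
    unfolding targets_def by blast
  then show ?thesis ..
qed

lemma targets_unique:
  assumes "inj_on prio V" "v \<in> targets V E prio h" "u \<in> targets V E prio h"
  shows "u = v"
proof -
  have "prio u \<le> prio v" "prio v \<le> prio u" "u \<in> V" "v \<in> V"
    using assms(2,3) unfolding targets_def unvisited_def by blast+
  then show ?thesis using assms(1) by (meson inj_onD order_antisym)
qed

text \<open>Removing one of u elements raises 1 / (1 + u) by 1 / (u * (1 + u)). At most u of the
  choices do so, hence the whole sum rises by at most 1 / (1 + u).\<close>

lemma expected_reciprocal:
  assumes M: "finite M" "M \<noteq> {}" and U: "finite U" and N: "0 < N" "N \<le> real (card M)"
  shows "(\<Sum>w\<in>M. 1 / (1 + real (card (U - {w})))) / real (card M) \<le>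
           (1 + 1 / N) / (1 + real (card U))"
proof -
  define u where "u = real (card U)"
  define m where "m = real (card M)"
  have m: "m > 0" using M by (simp add: m_def card_gt_0_iff)
  have u: "u \<ge> 0" by (simp add: u_def)
  have split: "1 / x = 1 / (1 + x) + 1 / (x * (1 + x))" if "x > 0" for x :: real
    using that by (simp add: divide_simps)
  have eq: "1 / (1 + real (card (U - {w}))) =
      1 / (1 + u) + (if w \<in> U then 1 / (u * (1 + u)) else 0)" for w
  proof (cases "w \<in> U")
    case True
    then have "1 + real (card (U - {w})) = u"
      using U card.remove[of U w] by (simp add: u_def)
    moreover from this have "u > 0" by linarith
    ultimately show ?thesis using True split[of u] by simp
  next
    case False
    then show ?thesis by (simp add: u_def)
  qed
  have "(\<Sum>w\<in>M. 1 / (1 + real (card (U - {w})))) =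
      m * (1 / (1 + u)) + real (card (M \<inter> U)) * (1 / (u * (1 + u)))"
    unfolding eq using M(1) by (simp add: sum.distrib sum.If_cases m_def)
  \<comment> \<open>For \<open>u = 0\<close> the left side is 0 because 1 / 0 = 0.\<close>
  also have "real (card (M \<inter> U)) * (1 / (u * (1 + u))) \<le> 1 / (1 + u)"
  proof (cases "u = 0")
    case False
    have "real (card (M \<inter> U)) \<le> u" using U by (simp add: u_def card_mono)
    then have "real (card (M \<inter> U)) * (1 / (u * (1 + u))) \<le> u * (1 / (u * (1 + u)))"
      using u by (intro mult_right_mono) auto
    then show ?thesis using False by simp
  qed simp
  finally have "(\<Sum>w\<in>M. 1 / (1 + real (card (U - {w})))) / m \<le>
      (m * (1 / (1 + u)) + 1 / (1 + u)) / m"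
    using m by (intro divide_right_mono) auto
  also have "\<dots> = (1 + 1 / m) / (1 + u)"
    using m u by (simp add: divide_simps)
  also have "\<dots> \<le> (1 + 1 / N) / (1 + u)"
  proof (rule divide_right_mono)
    show "1 + 1 / m \<le> 1 + 1 / N" using N by (simp add: m_def frac_le)
  qed (use u in simp)
  finally show ?thesis by (simp add: m_def u_def)
qed

section \<open>Breaker's strategy and its invariant\<close>

text \<open>This records only what the analysis uses of Breaker's play. The last clause keeps the
  target out of reach of the walker's next move.\<close>

locale isolating_strategy =
  fixes V :: "'a set" and E :: "'a set set" and prio :: "'a \<Rightarrow> nat" and \<sigma> :: "'a history \<Rightarrow> 'a set"
  assumes graph: "simple_graph V E"
    and inj_prio: "inj_on prio V"
    and strategy: "v \<in> targets V E prio h \<Longrightarrow> \<sigma> h \<in> open_edges E h \<and> v \<in> \<sigma> h \<and>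
      ({position h, v} \<in> open_edges E h \<longrightarrow> \<sigma> h = {position h, v})"
begin

lemma finite_V: "finite V"
  using graph by (simp add: simple_graph_def)

lemma edgeD: "e \<in> E \<Longrightarrow> e \<subseteq> V \<and> card e = 2"
  using graph by (auto simp: simple_graph_def)

lemma finite_unvisited: "finite (unvisited V h)"
  using finite_V by (simp add: unvisited_def)

lemma finite_isolated: "finite (isolated V E h)"
  using finite_unvisited isolated_subset_unvisited by (metis finite_subset)

lemma target_unique: "v \<in> targets V E prio h \<Longrightarrow> u \<in> targets V E prio h \<Longrightarrow> u = v"
  using targets_unique[OF inj_prio] .

lemma card_subset_targets:
  assumes "S \<subseteq> targets V E prio h"
  shows "finite S" "card S \<le> 1"
proof -
  obtain v where v: "S \<subseteq> {v}" using assms target_unique by blast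
  then show "finite S" by (rule finite_subset) simp
  show "card S \<le> 1" using card_mono[OF _ v] by simp
qed

text \<open>The vertices in \<open>S\<close> are those under attack; no walker's move can reach them.\<close>

definition attack :: "'a history \<Rightarrow> 'a set \<Rightarrow> bool" where
  "attack h S \<longleftrightarrow> S \<subseteq> targets V E prio h \<and>
     (\<forall>e \<in> set (acquired h). e \<inter> (isolated V E h \<union> S) \<noteq> {}) \<and>
     (to_move h = Walker \<longrightarrow> (\<forall>v \<in> S. {position h, v} \<notin> open_edges E h))"

text \<open>\<open>S\<close> is existential since no history stores it; it can be taken empty at the
  start and right after an attack is completed. Distinctness lets the length of
  \<open>acquired h\<close> count edges.\<close>

definition invariant :: "'a history \<Rightarrow> bool" where
  "invariant h \<longleftrightarrow> walk h \<noteq> [] \<and> visited h \<subseteq> V \<and> distinct (acquired h) \<and> set (acquired h) \<subseteq> E \<and>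
     (\<exists>S. attack h S)"

lemma invariant_initial: "v \<in> V \<Longrightarrow> invariant (History first [v] [])"
  by (auto simp: invariant_def visited_def attack_def)

text \<open>The walker arrives along an open edge, so her new vertex is neither isolated nor in
  \<open>S\<close>; the attack goes on undisturbed.\<close>

lemma walker_move:
  assumes "attack h S" "to_move h = Walker" "walk h \<noteq> []" "w \<in> walker_moves E h"
  defines "h' \<equiv> History Breaker (w # walk h) (acquired h)"
  shows "unvisited V h' = unvisited V h - {w}" "isolated V E h' = isolated V E h" "attack h' S"
proof -
  have op: "open_edges E h' = open_edges E h" by (simp add: h'_def open_edges_def)
  have w: "{position h, w} \<in> open_edges E h" using assms(4) by (simp add: walker_moves_def)
  show unv: "unvisited V h' = unvisited V h - {w}"
    by (auto simp: h'_def unvisited_def visited_def)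
  show iso: "isolated V E h' = isolated V E h"
    using w by (auto simp: isolated_def unv op)
  have "v \<in> targets V E prio h'" if "v \<in> S" for v
  proof -
    have v: "v \<in> targets V E prio h" using that assms(1) by (auto simp: attack_def)
    have "v \<noteq> w" using that w assms(1,2) by (auto simp: attack_def)
    then show ?thesis
      using v by (intro targets_anti_mono[OF v]) (auto simp: unv op targets_def)
  qed
  then show "attack h' S"
    using assms(1) iso by (auto simp: attack_def h'_def)
qed

text \<open>The new set is {v} while \<open>v\<close> keeps an open edge, and empty once
  \<open>v\<close> has become isolated; either way \<open>v\<close> accounts for the new
  edge.\<close>

lemma breaker_move:
  assumes "attack h S" "v \<in> targets V E prio h"
  defines "h' \<equiv> History Walker (walk h) (\<sigma> h # acquired h)"
  shows "unvisited V h' = unvisited V h" "isolated V E h \<subseteq> isolated V E h'"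
    "attack h' ({v} \<inter> \<Union>(open_edges E h'))"
proof -
  have op: "open_edges E h' = open_edges E h - {\<sigma> h}" by (auto simp: h'_def open_edges_def)
  have pos: "position h' = position h" by (simp add: h'_def position_def)
  note s = strategy[OF assms(2)]
  show unv: "unvisited V h' = unvisited V h"
    by (auto simp: h'_def unvisited_def visited_def)
  show iso: "isolated V E h \<subseteq> isolated V E h'"
    by (auto simp: isolated_def unv op)
  let ?S = "{v} \<inter> \<Union>(open_edges E h')"
  have v: "v \<in> unvisited V h" using assms(2) by (simp add: targets_def)
  have "?S \<subseteq> targets V E prio h'"
    using targets_anti_mono[OF assms(2), of h'] v unv op by auto
  moreover have "e \<inter> (isolated V E h' \<union> ?S) \<noteq> {}" if "e \<in> set (acquired h')" for e
  proof -
    have v': "v \<in> isolated V E h' \<union> ?S"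
      using v by (auto simp: isolated_def unv)
    \<comment> \<open>Targets are unique, so Breaker continues the attack in progress and never
      opens a second one.\<close>
    have "S \<subseteq> {v}"
      using assms(1,2) target_unique by (auto simp: attack_def)
    then have "e \<inter> (isolated V E h \<union> {v}) \<noteq> {}"
      using that s assms(1) unfolding attack_def h'_def by auto
    then show ?thesis using v' iso by blast
  qed
  \<comment> \<open>If this edge was open, then it is the edge \<open>\<sigma> h\<close> just
    taken.\<close>
  moreover have "{position h', v} \<notin> open_edges E h'"
    using s by (auto simp: op pos)
  ultimately show "attack h' ?S"
    unfolding attack_def by blast
qed

lemma step_cases:
  assumes "invariant h" "h' \<in> set_pmf (step V E \<sigma> h)"
  obtains (ended) "ended V E h" "h' = h"
  | (walker) w where "\<not> ended V E h" "to_move h = Walker" "w \<in> walker_moves E h"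
      "h' = History Breaker (w # walk h) (acquired h)"
  | (breaker) v where "\<not> ended V E h" "to_move h = Breaker" "v \<in> targets V E prio h"
      "h' = History Walker (walk h) (\<sigma> h # acquired h)"
proof (cases "ended V E h")
  case True
  then show ?thesis using assms that by (simp add: step_def)
next
  case ne: False
  have w: "walk h \<noteq> []" using assms(1) by (simp add: invariant_def)
  show ?thesis
  proof (cases "to_move h")
    case Walker
    then show ?thesis
      using assms(2) ne that(2) walker_moves_nonempty[OF w ne] finite_walker_moves[OF graph]
      by (auto simp: step_def)
  next
    case Breaker
    then show ?thesis
      using assms(2) ne that(3) not_ended_target[OF w ne] by (auto simp: step_def)
  qed
qed

lemma invariant_step:
  assumes "invariant h" "h' \<in> set_pmf (step V E \<sigma> h)"
  shows "invariant h'"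
proof -
  obtain S where S: "attack h S" using assms(1) by (auto simp: invariant_def)
  show ?thesis
    using assms
  proof (cases rule: step_cases)
    case ended
    then show ?thesis using assms by simp
  next
    case (walker w)
    have "{position h, w} \<in> E"
      using walker(3) by (simp add: walker_moves_def open_edges_def)
    then have "w \<in> V" using edgeD by auto
    then show ?thesis
      using walker_move(3)[OF S walker(2) _ walker(3)] assms(1) walker(4)
      by (auto simp: invariant_def visited_def)
  next
    case (breaker v)
    then show ?thesis
      using breaker_move(3)[OF S breaker(3)] strategy[OF breaker(3)] assms(1)
      by (auto simp: invariant_def visited_def open_edges_def)
  qed
qed

lemma invariant_play: "v \<in> V \<Longrightarrow> h \<in> set_pmf (play V E \<sigma> first v t) \<Longrightarrow> invariant h"
  by (induction t arbitrary: h) (auto simp: invariant_initial intro: invariant_step)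

section \<open>Counting acquired edges and available moves\<close>

lemma card_incident_edges: "card {e \<in> E. x \<in> e} \<le> card V"
proof -
  have "{e \<in> E. x \<in> e} \<subseteq> (\<lambda>y. {x, y}) ` V"
  proof
    fix e assume "e \<in> {e \<in> E. x \<in> e}"
    then have e: "x \<in> e" "e \<subseteq> V" "card e = 2" using edgeD by auto
    then obtain a b where "e = {a, b}" by (auto simp: card_2_iff)
    then have "e = {x, a} \<or> e = {x, b}" "a \<in> V" "b \<in> V" using e by auto
    then show "e \<in> (\<lambda>y. {x, y}) ` V" by auto
  qed
  then show ?thesis
    using finite_V by (meson card_image_le card_mono finite_imageI le_trans)
qed

text \<open>Every acquired edge meets an isolated vertex or the one vertex under attack, and each of
  these lies on at most \<open>card V\<close> edges.\<close>

lemma card_acquired: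
  assumes "invariant h"
  shows "length (acquired h) \<le> (card (isolated V E h) + 1) * card V"
proof -
  obtain S where S: "attack h S" using assms by (auto simp: invariant_def)
  note fS = card_subset_targets[of S h]
  let ?I = "isolated V E h \<union> S"
  have fin: "finite ?I" using S fS(1) finite_isolated by (simp add: attack_def)
  have "set (acquired h) \<subseteq> (\<Union>x\<in>?I. {e \<in> E. x \<in> e})"
  proof
    fix e assume e: "e \<in> set (acquired h)"
    then have "e \<in> E" using assms by (auto simp: invariant_def)
    moreover have "e \<inter> ?I \<noteq> {}" using S e by (simp add: attack_def)
    ultimately show "e \<in> (\<Union>x\<in>?I. {e \<in> E. x \<in> e})" by blast
  qed
  moreover have "finite (\<Union>x\<in>?I. {e \<in> E. x \<in> e})"
    using finite_edges[OF graph] fin by auto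
  ultimately have "card (set (acquired h)) \<le> card (\<Union>x\<in>?I. {e \<in> E. x \<in> e})"
    by (metis card_mono)
  also have "\<dots> \<le> (\<Sum>x\<in>?I. card {e \<in> E. x \<in> e})"
    by (rule card_UN_le[OF fin])
  also have "\<dots> \<le> card ?I * card V"
    using sum_bounded_above[of ?I "\<lambda>x. card {e \<in> E. x \<in> e}" "card V"] card_incident_edges by simp
  also have "\<dots> \<le> (card (isolated V E h) + 1) * card V"
    using card_Un_le[of "isolated V E h" S] fS(2) S by (intro mult_right_mono) (auto simp: attack_def)
  finally show ?thesis using assms by (simp add: invariant_def distinct_card)
qed

text \<open>The position is visited, hence neither isolated nor under attack. An acquired edge at it
  must therefore have such a vertex as its other end.\<close>

lemma card_walker_moves:
  assumes "invariant h" "to_move h = Walker"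
  shows "min_degree V E \<le> card (walker_moves E h) + (card (isolated V E h) + 1)"
proof -
  obtain S where S: "attack h S" using assms by (auto simp: invariant_def)
  note fS = card_subset_targets[of S h]
  let ?I = "isolated V E h \<union> S" and ?p = "position h"
  have p: "?p \<in> V" "?p \<in> visited h"
    using assms(1) position_visited by (auto simp: invariant_def)
  have fin: "finite ?I" using S fS(1) finite_isolated by (simp add: attack_def)
  have "?p \<notin> ?I"
    using S p(2) targets_subset_unvisited[of V E prio h]
    by (auto simp: attack_def isolated_def unvisited_def)
  then have "w \<in> ?I" if "{?p, w} \<in> set (acquired h)" for w
    using S that by (auto simp: attack_def)
  then have sub: "{w. {?p, w} \<in> E} \<subseteq> walker_moves E h \<union> ?I"
    by (auto simp: walker_moves_def open_edges_def)
  have "min_degree V E \<le> degree E ?p"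
    using p(1) finite_V by (simp add: min_degree_def)
  also have "\<dots> \<le> card (walker_moves E h \<union> ?I)"
    unfolding degree_def using fin finite_walker_moves[OF graph] sub by (intro card_mono) auto
  also have "\<dots> \<le> card (walker_moves E h) + (card (isolated V E h) + card S)"
    using card_Un_le[of "walker_moves E h" ?I] card_Un_le[of "isolated V E h" S] by linarith
  finally show ?thesis using fS(2) S by (auto simp: attack_def)
qed

section \<open>A potential that does not increase in expectation\<close>

text \<open>
  Breaker's turn counts as one acquired edge in advance, so that the exponent counts the moves of
  the walker.
\<close>

definition potential :: "nat \<Rightarrow> real \<Rightarrow> 'a history \<Rightarrow> real" where
  "potential k r h =
     (if card (isolated V E h) < k
      then 1 / (r ^ (length (acquired h) + (if to_move h = Breaker then 1 else 0)) *
                (1 + real (card (unvisited V h))))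
      else 0)"

lemma potential_nonneg: "r > 0 \<Longrightarrow> potential k r h \<ge> 0"
  by (simp add: potential_def)

text \<open>The turn passes to Breaker, so the exponent grows by one. This extra factor of the
  denominator cancels the growth by 1 + 1 / N in \<open>expected_reciprocal\<close>.\<close>

lemma potential_walker_step:
  assumes "invariant h" "\<not> ended V E h" "to_move h = Walker"
    and N: "0 < N" "N + real k \<le> real (min_degree V E)"
  shows "(\<Sum>w\<in>walker_moves E h. potential k (1 + 1 / N) (History Breaker (w # walk h) (acquired h)))
           / real (card (walker_moves E h)) \<le> potential k (1 + 1 / N) h"
proof -
  obtain S where S: "attack h S" and ne: "walk h \<noteq> []" using assms(1) by (auto simp: invariant_def)
  let ?M = "walker_moves E h" and ?r = "1 + 1 / N" and ?a = "length (acquired h)"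
  let ?g = "\<lambda>w. History Breaker (w # walk h) (acquired h)"
  have M: "finite ?M" "?M \<noteq> {}"
    using finite_walker_moves[OF graph] walker_moves_nonempty[OF ne assms(2)] by auto
  note move = walker_move[OF S assms(3) ne]
  show ?thesis
  proof (cases "card (isolated V E h) < k")
    case True
    \<comment> \<open>At most k - 1 isolated vertices and one vertex under attack cost the position
      at most k edges.\<close>
    have "N \<le> real (card ?M)"
      using card_walker_moves[OF assms(1,3)] True N(2) by linarith
    note e = expected_reciprocal[OF M finite_unvisited[of h] N(1) this]
    have "(\<Sum>w\<in>?M. potential k ?r (?g w)) =
        (\<Sum>w\<in>?M. 1 / (1 + real (card (unvisited V h - {w}))) / ?r ^ (?a + 1))"
      using True by (intro sum.cong) (simp_all add: potential_def move(1,2) field_simps)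
    then have "(\<Sum>w\<in>?M. potential k ?r (?g w)) / real (card ?M) =
        (\<Sum>w\<in>?M. 1 / (1 + real (card (unvisited V h - {w})))) / real (card ?M) / ?r ^ (?a + 1)"
      by (simp add: sum_divide_distrib mult_ac)
    also have "\<dots> \<le> ?r / (1 + real (card (unvisited V h))) / ?r ^ (?a + 1)"
      using N(1) by (intro divide_right_mono[OF e]) simp
    also have "\<dots> = potential k ?r h"
      using True assms(3) N(1) by (simp add: potential_def add_pos_pos less_imp_neq[symmetric])
    finally show ?thesis .
  next
    case False
    then have "potential k ?r (?g w) = 0" if "w \<in> ?M" for w
      using move(2)[OF that] by (simp add: potential_def)
    then show ?thesis using potential_nonneg[of ?r k h] N(1) by (simp add: add_pos_pos)
  qed
qed

text \<open>The new edge replaces the one counted in advance, so the exponent is unchanged. More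
  isolated vertices can only turn the value into 0.\<close>

lemma potential_breaker_step:
  assumes "attack h S" "to_move h = Breaker" "v \<in> targets V E prio h" "r > 0"
  shows "potential k r (History Walker (walk h) (\<sigma> h # acquired h)) \<le> potential k r h"
proof -
  let ?g = "History Walker (walk h) (\<sigma> h # acquired h)"
  note move = breaker_move[OF assms(1,3)]
  have "card (isolated V E h) \<le> card (isolated V E ?g)"
    using move(2) finite_isolated by (rule card_mono[rotated])
  then show ?thesis
    using assms(2,4) potential_nonneg[OF assms(4), of k h] by (simp add: potential_def move(1))
qed

text \<open>The supermartingale property, stated with nonnegative integrals to avoid integrability
  conditions.\<close>

lemma potential_step:
  assumes "invariant h" and N: "0 < N" "N + real k \<le> real (min_degree V E)"
  shows "(\<integral>\<^sup>+ h'. ennreal (potential k (1 + 1 / N) h') \<partial>measure_pmf (step V E \<sigma> h)) \<le>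
           ennreal (potential k (1 + 1 / N) h)"
proof (cases "ended V E h")
  case True
  then show ?thesis by (simp add: step_def)
next
  case ne: False
  obtain S where S: "attack h S" and w: "walk h \<noteq> []" using assms(1) by (auto simp: invariant_def)
  have r: "1 + 1 / N > 0" using N(1) by (simp add: add_pos_pos)
  show ?thesis
  proof (cases "to_move h")
    case Walker
    let ?M = "walker_moves E h"
    have M: "finite ?M" "?M \<noteq> {}"
      using finite_walker_moves[OF graph] walker_moves_nonempty[OF w ne] by auto
    then have "real (card ?M) > 0" by (simp add: card_gt_0_iff)
    then show ?thesis
      using potential_walker_step[OF assms(1) ne Walker N] M ne Walker r
      by (simp add: step_def nn_integral_pmf_of_set potential_nonneg sum_ennreal sum_nonneg
          ennreal_of_nat_eq_real_of_nat divide_ennreal)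
  next
    case Breaker
    obtain v where "v \<in> targets V E prio h" using not_ended_target[OF w ne] by auto
    then show ?thesis
      using potential_breaker_step[OF S Breaker _ r] Breaker ne by (simp add: step_def ennreal_leI)
  qed
qed

lemma potential_play:
  assumes "v \<in> V" and N: "0 < N" "N + real k \<le> real (min_degree V E)"
  shows "(\<integral>\<^sup>+ h. ennreal (potential k (1 + 1 / N) h) \<partial>measure_pmf (play V E \<sigma> first v t)) \<le>
           ennreal (1 / real (card V))"
proof (induction t)
  case 0
  let ?h = "History first [v] []"
  \<comment> \<open>The start is visited, so the initial value is exactly 1 / \<open>card V\<close>
    unless Breaker moves first or k = 0, when it is smaller.\<close>
  have "card V = card (unvisited V ?h) + 1"
    using assms(1) finite_V card.remove[of V v] by (simp add: unvisited_def visited_def)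
  then have "potential k (1 + 1 / N) ?h \<le> 1 / real (card V)"
    using N(1) by (simp add: potential_def add.commute divide_left_mono mult_le_cancel_right1 add_pos_pos)
  then show ?case by (simp add: ennreal_leI)
next
  case (Suc t)
  let ?\<phi> = "\<lambda>h. ennreal (potential k (1 + 1 / N) h)"
  have "(\<integral>\<^sup>+ h. ?\<phi> h \<partial>measure_pmf (play V E \<sigma> first v (Suc t))) =
      (\<integral>\<^sup>+ h. (\<integral>\<^sup>+ h'. ?\<phi> h' \<partial>measure_pmf (step V E \<sigma> h)) \<partial>measure_pmf (play V E \<sigma> first v t))"
    by simp
  also have "\<dots> \<le> (\<integral>\<^sup>+ h. ?\<phi> h \<partial>measure_pmf (play V E \<sigma> first v t))"
    using potential_step[OF _ N] invariant_play[OF assms(1)]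
    by (intro nn_integral_mono_AE) (auto simp: AE_measure_pmf_iff)
  also note Suc.IH
  finally show ?case .
qed

text \<open>Markov's inequality by hand: on the event the potential is at least 1 /
  \<open>?C\<close>. The exponent comes from the number of acquired edges, so the bound is uniform
  in \<open>t\<close>.\<close>

lemma prob_few_unvisited:
  assumes "v \<in> V" and N: "0 < N" "N + real k \<le> real (min_degree V E)"
  shows "measure_pmf.prob (play V E \<sigma> first v t) {h. card (unvisited V h) < k} \<le>
           real k / real (card V) * (1 + 1 / N) ^ (k * card V + 1)"
proof -
  let ?P = "play V E \<sigma> first v t" and ?B = "{h. card (unvisited V h) < k}"
  let ?r = "1 + 1 / N"
  let ?C = "real k * ?r ^ (k * card V + 1)"
  have C: "?C \<ge> 0" using N(1) by simp
  have "indicator ?B h \<le> ennreal ?C * ennreal (potential k ?r h)" if h: "h \<in> set_pmf ?P" for h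
  proof (cases "h \<in> ?B")
    case True
    note i = invariant_play[OF assms(1) h]
    \<comment> \<open>On the event the potential has not been cut off to 0, since isolated vertices
      are unvisited.\<close>
    have W: "card (isolated V E h) < k"
      using True card_mono[OF finite_unvisited isolated_subset_unvisited, of E h] by simp
    have "length (acquired h) \<le> k * card V"
      using card_acquired[OF i] W mult_right_mono[of "card (isolated V E h) + 1" k "card V"]
      by linarith
    then have "?r ^ (length (acquired h) + (if to_move h = Breaker then 1 else 0)) \<le>
        ?r ^ (k * card V + 1)" (is "?x \<le> ?y")
      using N(1) by (intro power_increasing) auto
    moreover have "1 + real (card (unvisited V h)) \<le> real k" (is "?z \<le> _")
      using True by simp
    ultimately have "?x * ?z \<le> ?y * real k"
      using N(1) by (intro mult_mono) auto
    moreover have "?x * ?z > 0"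
      using N(1) by (intro mult_pos_pos zero_less_power) (auto simp: add_pos_nonneg)
    ultimately have "1 \<le> ?C * potential k ?r h"
      using W by (simp add: potential_def mult.commute del: power_Suc)
    then show ?thesis
      using True C by (simp add: ennreal_mult'[symmetric] del: power_Suc)
  qed simp
  then have "(\<integral>\<^sup>+ h. indicator ?B h \<partial>measure_pmf ?P) \<le>
      (\<integral>\<^sup>+ h. ennreal ?C * ennreal (potential k ?r h) \<partial>measure_pmf ?P)"
    by (intro nn_integral_mono_AE) (simp add: AE_measure_pmf_iff)
  then have "emeasure (measure_pmf ?P) ?B \<le>
      (\<integral>\<^sup>+ h. ennreal ?C * ennreal (potential k ?r h) \<partial>measure_pmf ?P)"
    by simp
  also have "\<dots> = ennreal ?C * (\<integral>\<^sup>+ h. ennreal (potential k ?r h) \<partial>measure_pmf ?P)"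
    by (rule nn_integral_cmult) simp
  also have "\<dots> \<le> ennreal ?C * ennreal (1 / real (card V))"
    using potential_play[OF assms(1) N] by (rule mult_left_mono) simp
  also have "\<dots> = ennreal (?C * (1 / real (card V)))"
    using C by (rule ennreal_mult'[symmetric])
  finally show ?thesis
    using C by (simp add: measure_pmf.emeasure_eq_measure mult_ac)
qed

end

section \<open>Existence of a legal isolating strategy\<close>

lemma isolating_strategy_exists:
  fixes V :: "'a set"
  assumes "simple_graph V E"
  shows "\<exists>prio \<sigma>. isolating_strategy V E prio \<sigma> \<and> breaker_strategy E \<sigma>"
proof -
  have "finite V" using assms by (simp add: simple_graph_def)
  then obtain prio :: "'a \<Rightarrow> nat" where prio: "inj_on prio V"
    using finite_imp_inj_to_nat_seg by metis
  \<comment> \<open>Legality is demanded separately because \<open>breaker_strategy\<close> also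
    constrains histories without a target; any legal edge serves there.\<close>
  let ?good = "\<lambda>h e. (\<forall>v \<in> targets V E prio h. e \<in> open_edges E h \<and> v \<in> e \<and>
      ({position h, v} \<in> open_edges E h \<longrightarrow> e = {position h, v}))
      \<and> (breaker_moves E h \<noteq> {} \<longrightarrow> e \<in> breaker_moves E h)"
  have "\<exists>e. ?good h e" for h
  proof (cases "targets V E prio h = {}")
    case False
    then obtain v where v: "v \<in> targets V E prio h" by auto
    then have T: "targets V E prio h = {v}" using targets_unique[OF prio] by blast
    obtain e where e: "e \<in> open_edges E h" "v \<in> e"
      "{position h, v} \<in> open_edges E h \<longrightarrow> e = {position h, v}"
      using v unfolding targets_def by blast
    \<comment> \<open>An edge with an unvisited end cannot have been traversed, so it is
      legal.\<close>
    have "v \<notin> visited h" using v by (simp add: targets_def unvisited_def)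
    then have "e \<in> breaker_moves E h"
      using e traversed_subset_visited[of e h] by (auto simp: breaker_moves_def)
    then show ?thesis using T e by auto
  qed auto
  then obtain \<sigma> where \<sigma>: "\<And>h. ?good h (\<sigma> h)" by metis
  then have "isolating_strategy V E prio \<sigma>"
    using assms prio by unfold_locales auto
  then show ?thesis using \<sigma> by (auto simp: breaker_strategy_def)
qed

section \<open>Asymptotics of the probability bound\<close>

text \<open>\<open>K\<close> is an upper bound for \<lceil>c * ln n\<rceil>, and the exponential
  comes from 1 + x \<le> exp x. The value 0 makes the claim trivial for those n with N \<le>
  0.\<close>

definition success_bound :: "real \<Rightarrow> real \<Rightarrow> nat \<Rightarrow> real" where
  "success_bound \<alpha> c n =
     (let K = c * ln (real n) + 1; N = \<alpha> * real n - K
      in if N > 0 then 1 - K / real n * exp ((K * real n + 1) / N) else 0)"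

text \<open>The exponent is asymptotic to (c / \<alpha>) * ln n. As c < \<alpha>, some \<beta> < 1
  exceeds c / \<alpha>, and the error is eventually at most K / n * n powr \<beta>, which tends to
  0.\<close>

lemma success_bound_tendsto:
  assumes "0 < c" "c < \<alpha>"
  shows "success_bound \<alpha> c \<longlonglongrightarrow> 1"
proof -
  have \<alpha>: "\<alpha> > 0" using assms by simp
  define K where "K = (\<lambda>n::nat. c * ln (real n) + 1)"
  define N where "N = (\<lambda>n. \<alpha> * real n - K n)"
  let ?f = "\<lambda>n. K n / real n * exp ((K n * real n + 1) / N n)"
  have N: "eventually (\<lambda>n. N n > 0) sequentially"
    unfolding N_def K_def using \<alpha> by real_asymp
  obtain \<beta> where \<beta>: "c / \<alpha> < \<beta>" "\<beta> < 1"
    using assms \<alpha> dense[of "c / \<alpha>" 1] by auto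
  have "(\<lambda>n. (K n * real n + 1) / N n / ln (real n)) \<longlonglongrightarrow> c / \<alpha>"
    unfolding N_def K_def using assms(1) \<alpha> by (real_asymp simp: field_simps)
  then have "eventually (\<lambda>n. (K n * real n + 1) / N n / ln (real n) < \<beta>) sequentially"
    using \<beta>(1) by (rule order_tendstoD)
  then have f: "eventually (\<lambda>n. 0 \<le> ?f n \<and> ?f n \<le> K n / real n * real n powr \<beta>) sequentially"
    using eventually_gt_at_top[of 1]
  proof eventually_elim
    case (elim n)
    have ln: "ln (real n) > 0" using elim(2) by simp
    then have K: "K n \<ge> 0" using assms(1) by (simp add: K_def)
    have "(K n * real n + 1) / N n \<le> \<beta> * ln (real n)"
      using elim(1) ln by (simp only: pos_divide_less_eq less_imp_le)
    then have "exp ((K n * real n + 1) / N n) \<le> real n powr \<beta>"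
      using elim(2) by (simp add: powr_def)
    then show ?case using K by (intro conjI mult_left_mono) auto
  qed
  have "(\<lambda>n. K n / real n * real n powr \<beta>) \<longlonglongrightarrow> 0"
    unfolding K_def using assms(1) \<beta>(2) by real_asymp
  then have "?f \<longlonglongrightarrow> 0"
    by (rule tendsto_sandwich[rotated 3]) (use f in \<open>auto elim: eventually_mono\<close>)
  then have "(\<lambda>n. 1 - ?f n) \<longlonglongrightarrow> 1 - 0"
    by (intro tendsto_diff tendsto_const)
  moreover have "eventually (\<lambda>n. 1 - ?f n = success_bound \<alpha> c n) sequentially"
    using N by eventually_elim (simp add: success_bound_def Let_def N_def K_def)
  ultimately show ?thesis
    using Lim_transform_eventually by fastforce
qed

section \<open>From the tail bound to the outcome of the game\<close>

theorem theorem6: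
  fixes \<alpha> c :: real
  assumes "\<alpha> > 0" and "0 < c" and "c < \<alpha>"
  shows "\<exists>p :: nat \<Rightarrow> real. p \<longlonglongrightarrow> 1 \<and>
    (\<forall>n (V :: 'a set) E.
       simple_graph V E \<and> card V = n \<and> \<alpha> * real n \<le> real (min_degree V E) \<longrightarrow>
       (\<exists>\<sigma>. breaker_strategy E \<sigma> \<and>
          (\<forall>first. \<forall>v\<in>V.
             measure_pmf.prob (game_outcome V E \<sigma> first v)
               {h. real (card (visited h)) \<le> real n - c * ln (real n)} \<ge> p n)))"
proof (intro exI[of _ "success_bound \<alpha> c"] conjI allI impI)
  \<comment> \<open>One sequence serves all graphs, as it depends only on \<alpha>, c and n.\<close>
  show "success_bound \<alpha> c \<longlonglongrightarrow> 1" using assms by (intro success_bound_tendsto)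
next
  fix n and V :: "'a set" and E
  assume "simple_graph V E \<and> card V = n \<and> \<alpha> * real n \<le> real (min_degree V E)"
  then have G: "simple_graph V E" and n: "card V = n" and deg: "\<alpha> * real n \<le> real (min_degree V E)"
    by auto
  obtain prio \<sigma> where iso: "isolating_strategy V E prio \<sigma>" and \<sigma>: "breaker_strategy E \<sigma>"
    using isolating_strategy_exists[OF G] by auto
  interpret isolating_strategy V E prio \<sigma> by (rule iso)
  have "n > 0" using G n by (auto simp: simple_graph_def card_gt_0_iff)
  \<comment> \<open>Rounding up makes \<open>k\<close> unvisited vertices suffice for the claim, at
    the cost of the summand 1 in \<open>K\<close>.\<close>
  define k where "k = nat \<lceil>c * ln (real n)\<rceil>"
  define K where "K = c * ln (real n) + 1"
  define N where "N = \<alpha> * real n - K"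
  have "c * ln (real n) \<ge> 0" using \<open>n > 0\<close> assms(2) by simp
  then have k: "c * ln (real n) \<le> real k" "real k \<le> K" unfolding k_def K_def by linarith+
  have "success_bound \<alpha> c n \<le> measure_pmf.prob (game_outcome V E \<sigma> first v)
      {h. real (card (visited h)) \<le> real n - c * ln (real n)}" (is "_ \<le> measure_pmf.prob ?P ?A")
    if v: "v \<in> V" for first v
  proof (cases "N > 0")
    case True
    let ?B = "{h. card (unvisited V h) < k}"
    have "(1 + 1 / N) ^ (k * n + 1) \<le> exp (1 / N) ^ (k * n + 1)"
      using True by (intro power_mono) auto
    also have "\<dots> = exp ((real k * real n + 1) / N)"
      by (simp add: exp_of_nat_mult[symmetric] del: power_Suc)
    also have "\<dots> \<le> exp ((K * real n + 1) / N)"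
      using True k(2) by (simp add: divide_right_mono mult_right_mono)
    finally have pow: "(1 + 1 / N) ^ (k * n + 1) \<le> exp ((K * real n + 1) / N)" .
    have "measure_pmf.prob ?P ?B \<le> real k / real n * (1 + 1 / N) ^ (k * n + 1)"
      using prob_few_unvisited[OF v True, of k] deg k(2)
      unfolding game_outcome_def N_def n by simp
    also have "\<dots> \<le> K / real n * exp ((K * real n + 1) / N)"
      using pow k True by (intro mult_mono divide_right_mono) auto
    finally have B: "measure_pmf.prob ?P ?B \<le> 1 - success_bound \<alpha> c n"
      using True by (simp add: success_bound_def N_def K_def Let_def)
    \<comment> \<open>\<open>visited h \<subseteq> V\<close> is known only on the support, so the
      inclusion of events holds almost surely.\<close>
    have "h \<in> ?A" if h: "h \<in> set_pmf ?P" and "h \<notin> ?B" for h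
    proof -
      have "visited h \<subseteq> V"
        using invariant_play[OF v] h unfolding game_outcome_def invariant_def by blast
      then have "real (card (unvisited V h)) = real n - real (card (visited h))"
        using n finite_V card_mono[of V "visited h"]
        by (simp add: unvisited_def card_Diff_subset finite_subset of_nat_diff)
      then show ?thesis using that(2) k(1) by simp
    qed
    then have "measure_pmf.prob ?P (- ?B) \<le> measure_pmf.prob ?P ?A"
      by (intro measure_pmf.finite_measure_mono_AE) (auto simp: AE_measure_pmf_iff)
    then show ?thesis
      using B measure_pmf.prob_compl[of ?B ?P] by (simp add: Compl_eq_Diff_UNIV)
  next
    case False
    then show ?thesis by (simp add: success_bound_def N_def K_def Let_def)
  qed
  then show "\<exists>\<sigma>. breaker_strategy E \<sigma> \<and>
      (\<forall>first. \<forall>v\<in>V. measure_pmf.prob (game_outcome V E \<sigma> first v)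
         {h. real (card (visited h)) \<le> real n - c * ln (real n)} \<ge> success_bound \<alpha> c n)"
    using \<sigma> by blast
qed

end
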